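(* Let $G=(V,E)$ be a finite graph, $\beta>0$, $\pmb{J}=(J_{ij})\in[0,\infty)^E$, $p_{ij}=1-\exp(-2\beta J_{ij})$ and $\pmb{h}=(h_i)\in\mathbb{R}^V$. For any fixed $x\in V$, $$\lambda_{\beta,\pmb{h},V}(\sigma_x)=\phi_{\pmb{p},\pmb{h},G}\big(\tanh(\pmb{h}(K_t))\big),$$ where $K_t=K_t(\omega)$ is the open connected component containing $x$.
   Context: Ising measure with free boundary condition: $\lambda_{\beta,\pmb{h},V}(\sigma)\propto\exp\big(\beta\sum_{\{i,j\}\in E}J_{ij}\sigma_i\sigma_j+\beta\sum_{i\in V}h_i\sigma_i\big)$ on $\{-1,+1\}^V$, normalized to be a probability; $\lambda(f)$ and $\phi(f)$ denote expectations. For $\omega\in\{0,1\}^E$, $\eta(\omega)=\{e:\omega_e=1\}$ is the set of open edges; $K_1,\dots,K_{k(\omega,G)}$ are the (vertex sets of the) connected components of $(V,\eta(\omega))$; $\pmb{h}(K)=\beta\sum_{i\in K}h_i$; and $B_{\pmb{J}}(\omega)=\prod_{\{i,j\}:\omega_{ij}=1}p_{ij}\prod_{\{i,j\}:\omega_{ij}=0}(1-p_{ij})$. The random-cluster measure is $\phi_{\pmb{p},\pmb{h},G}(\omega)\propto B_{\pmb{J}}(\omega)\prod_{\alpha=1}^{k(\omega,G)}2\cosh(\pmb{h}(K_\alpha))$, normalized to be a probability on $\{0,1\}^E$. *)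

theory Defs
  imports "HOL-Probability.Probability"
begin

locale finite_simple_graph =
  fixes V :: "'a set" and E :: "'a set set"
  assumes finite_V: "finite V"
    and edge_subset: "e \<in> E \<Longrightarrow> e \<subseteq> V"
    and edge_card: "e \<in> E \<Longrightarrow> card e = 2"
begin

lemma finite_E: "finite E"
  using finite_V edge_subset by (meson Pow_iff finite_Pow_iff finite_subset subsetI)

end

definition joined :: "'a set \<Rightarrow> 'a set set \<Rightarrow> ('a \<times> 'a) set" where
  "joined V A = {(u, v). u \<in> V \<and> v \<in> V \<and> (u, v) \<in> {(i, j). {i, j} \<in> A}\<^sup>*}"

definition components :: "'a set \<Rightarrow> 'a set set \<Rightarrow> 'a set set" where
  "components V A = V // joined V A"

definition component_of :: "'a set \<Rightarrow> 'a set set \<Rightarrow> 'a \<Rightarrow> 'a set" where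
  "component_of V A x = joined V A `` {x}"

lemma equiv_joined: "equiv V (joined V A)"
proof -
  have "sym {(i, j). {i, j} \<in> A}"
    by (auto simp: sym_def insert_commute)
  then have "sym ({(i, j). {i, j} \<in> A}\<^sup>*)"
    by (rule sym_rtrancl)
  then show ?thesis
    unfolding equiv_def refl_on_def joined_def
    by (auto simp: sym_def trans_def intro: rtrancl_trans)
qed

lemma component_of_unique:
  assumes "x \<in> V"
  shows "K \<in> components V A \<and> x \<in> K \<longleftrightarrow> K = component_of V A x"
proof
  assume "K \<in> components V A \<and> x \<in> K"
  then show "K = component_of V A x"
    unfolding components_def component_of_def
    by (metis Image_singleton_iff equiv_class_eq_iff equiv_joined quotientE)
next
  assume "K = component_of V A x"
  then show "K \<in> components V A \<and> x \<in> K"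
    unfolding components_def component_of_def
    using assms equiv_class_self[OF equiv_joined assms] by (auto intro: quotientI)
qed

definition normalized_measure :: "'b set \<Rightarrow> ('b \<Rightarrow> real) \<Rightarrow> 'b measure" where
  "normalized_measure \<Omega> w = point_measure \<Omega> (\<lambda>x. ennreal (w x / (\<Sum>y\<in>\<Omega>. w y)))"

lemma prob_space_normalized_measure:
  assumes "finite \<Omega>" and nonneg: "\<And>x. x \<in> \<Omega> \<Longrightarrow> 0 \<le> w x" and pos: "0 < (\<Sum>x\<in>\<Omega>. w x)"
  shows "prob_space (normalized_measure \<Omega> w)"
proof
  have "(\<Sum>x\<in>\<Omega>. ennreal (w x / (\<Sum>y\<in>\<Omega>. w y))) = ennreal (\<Sum>x\<in>\<Omega>. w x / (\<Sum>y\<in>\<Omega>. w y))"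
    using nonneg pos by (intro sum_ennreal) auto
  also have "\<dots> = 1"
    using pos by (simp flip: sum_divide_distrib)
  finally show "emeasure (normalized_measure \<Omega> w) (space (normalized_measure \<Omega> w)) = 1"
    unfolding normalized_measure_def space_point_measure
    using \<open>finite \<Omega>\<close> by (simp add: emeasure_point_measure_finite)
qed

definition spin_configs :: "'a set \<Rightarrow> ('a \<Rightarrow> real) set" where
  "spin_configs V = V \<rightarrow>\<^sub>E {-1, 1}"

text \<open>For an edge \<open>e = {i, j}\<close> with \<open>i \<noteq> j\<close>, the product over \<open>e\<close> below is \<open>\<sigma> i * \<sigma> j\<close>.\<close>

definition ising_weight ::
  "'a set \<Rightarrow> 'a set set \<Rightarrow> real \<Rightarrow> ('a set \<Rightarrow> real) \<Rightarrow> ('a \<Rightarrow> real) \<Rightarrow> ('a \<Rightarrow> real) \<Rightarrow> real" where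
  "ising_weight V E \<beta> J h \<sigma> =
     exp (\<beta> * (\<Sum>e\<in>E. J e * (\<Prod>i\<in>e. \<sigma> i)) + \<beta> * (\<Sum>i\<in>V. h i * \<sigma> i))"

definition ising_measure ::
  "'a set \<Rightarrow> 'a set set \<Rightarrow> real \<Rightarrow> ('a set \<Rightarrow> real) \<Rightarrow> ('a \<Rightarrow> real) \<Rightarrow> ('a \<Rightarrow> real) measure" where
  "ising_measure V E \<beta> J h = normalized_measure (spin_configs V) (ising_weight V E \<beta> J h)"

definition edge_configs :: "'a set set \<Rightarrow> ('a set \<Rightarrow> nat) set" where
  "edge_configs E = E \<rightarrow>\<^sub>E {0, 1}"

definition open_edges :: "'a set set \<Rightarrow> ('a set \<Rightarrow> nat) \<Rightarrow> 'a set set" where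
  "open_edges E \<omega> = {e \<in> E. \<omega> e = 1}"

definition cluster_field :: "real \<Rightarrow> ('a \<Rightarrow> real) \<Rightarrow> 'a set \<Rightarrow> real" where
  "cluster_field \<beta> h K = \<beta> * (\<Sum>i\<in>K. h i)"

definition bernoulli_weight :: "'a set set \<Rightarrow> ('a set \<Rightarrow> real) \<Rightarrow> ('a set \<Rightarrow> nat) \<Rightarrow> real" where
  "bernoulli_weight E p \<omega> = (\<Prod>e\<in>{e \<in> E. \<omega> e = 1}. p e) * (\<Prod>e\<in>{e \<in> E. \<omega> e = 0}. 1 - p e)"

definition rc_weight ::
  "'a set \<Rightarrow> 'a set set \<Rightarrow> real \<Rightarrow> ('a set \<Rightarrow> real) \<Rightarrow> ('a \<Rightarrow> real) \<Rightarrow> ('a set \<Rightarrow> nat) \<Rightarrow> real" where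
  "rc_weight V E \<beta> p h \<omega> =
     bernoulli_weight E p \<omega> * (\<Prod>K\<in>components V (open_edges E \<omega>). 2 * cosh (cluster_field \<beta> h K))"

definition rc_measure ::
  "'a set \<Rightarrow> 'a set set \<Rightarrow> real \<Rightarrow> ('a set \<Rightarrow> real) \<Rightarrow> ('a \<Rightarrow> real) \<Rightarrow> ('a set \<Rightarrow> nat) measure" where
  "rc_measure V E \<beta> p h = normalized_measure (edge_configs E) (rc_weight V E \<beta> p h)"

context finite_simple_graph
begin

lemma prob_space_ising_measure: "prob_space (ising_measure V E \<beta> J h)"
  unfolding ising_measure_def
proof (rule prob_space_normalized_measure)
  show fin: "finite (spin_configs V)"
    unfolding spin_configs_def using finite_V by (intro finite_PiE) auto
  have "spin_configs V \<noteq> {}"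
    by (simp add: spin_configs_def PiE_eq_empty_iff)
  then show "0 < (\<Sum>\<sigma>\<in>spin_configs V. ising_weight V E \<beta> J h \<sigma>)"
    using fin by (intro sum_pos) (auto simp: ising_weight_def)
qed (simp add: ising_weight_def)

lemma prob_space_rc_measure:
  assumes p: "\<And>e. e \<in> E \<Longrightarrow> 0 \<le> p e \<and> p e < 1"
  shows "prob_space (rc_measure V E \<beta> p h)"
  unfolding rc_measure_def
proof (rule prob_space_normalized_measure)
  let ?w = "rc_weight V E \<beta> p h"
  let ?c = "\<lambda>e. if e \<in> E then 0 else undefined :: nat"
  show fin: "finite (edge_configs E)"
    unfolding edge_configs_def using finite_E by (intro finite_PiE) auto
  have cosh: "0 < (\<Prod>K\<in>components V A. 2 * cosh (cluster_field \<beta> h K))" for A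
    by (intro prod_pos) (simp add: cosh_real_pos)
  show nonneg: "0 \<le> ?w \<omega>" for \<omega>
    unfolding rc_weight_def bernoulli_weight_def using p
    by (intro mult_nonneg_nonneg prod_nonneg less_imp_le[OF cosh]) (auto simp: less_imp_le)
  have "?c \<in> edge_configs E"
    by (auto simp: edge_configs_def)
  moreover have "0 < ?w ?c"
    unfolding rc_weight_def bernoulli_weight_def using p
    by (intro mult_pos_pos prod_pos cosh) (auto split: if_splits)
  ultimately show "0 < (\<Sum>\<omega>\<in>edge_configs E. ?w \<omega>)"
    using fin nonneg by (intro sum_pos2) auto
qed

end

end

theory Submission
  imports Defs
begin

text \<open>
  The proof is the Edwards--Sokal coupling. For an edge \<open>e = {i, j}\<close> the product
  \<open>\<sigma> i * \<sigma> j\<close> is \<open>1\<close> or \<open>-1\<close>, so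
  \<open>exp (\<beta> * J e * \<sigma> i * \<sigma> j) = exp (\<beta> * J e) * ((1 - p e) + p e * [\<sigma> i = \<sigma> j])\<close>
  because \<open>1 - p e = exp (-2 * \<beta> * J e)\<close>. Multiplying out over the edges and reading the choice of
  the summand \<open>p e * [\<sigma> i = \<sigma> j]\<close> as ``\<open>e\<close> is open'' turns the Ising weight into a sum over edge
  configurations (\<open>ising_weight_expand\<close>): a Bernoulli weight times the external field factor,
  restricted to the spins that agree along every open edge.

  Now sum over the spins first. A configuration that agrees along the open edges is
  the same thing as a free choice of one sign per open cluster (\<open>bij_betw_cluster_spins\<close>), and
  the field factor is a product over clusters, so the sum factorizes
  (\<open>sum_compatible_eq_prod_components\<close>). Each cluster \<open>K\<close> with field \<open>H\<close> contributes
  \<open>exp H + exp (- H) = 2 * cosh H\<close>; if the observable \<open>\<sigma> x\<close> is inserted, the cluster of \<open>x\<close>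
  contributes \<open>exp H - exp (- H) = 2 * cosh H * tanh H\<close> instead. Hence, up to the common constant
  \<open>exp (\<beta> * sum J E)\<close>, the two partition functions agree, and so do the numerators of the two
  expectations.
\<close>

section \<open>Expectations under normalized weights\<close>

text \<open>Nonnegative weights survive the passage through \<open>ennreal\<close>, which truncates negative values
  to \<open>0\<close>; for the random-cluster weights this is where \<open>0 \<le> p e \<le> 1\<close> enters.\<close>

lemma integral_normalized_measure:
  fixes w f :: "'b \<Rightarrow> real"
  assumes "finite \<Omega>" and nonneg: "\<And>y. y \<in> \<Omega> \<Longrightarrow> 0 \<le> w y"
  shows "(\<integral>y. f y \<partial>normalized_measure \<Omega> w) = (\<Sum>y\<in>\<Omega>. w y * f y) / (\<Sum>y\<in>\<Omega>. w y)"
proof -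
  have "(\<integral>y. f y \<partial>normalized_measure \<Omega> w) = (\<Sum>y\<in>\<Omega>. w y / (\<Sum>y\<in>\<Omega>. w y) * f y)"
    unfolding normalized_measure_def using assms
    by (subst lebesgue_integral_point_measure_finite) (auto intro!: divide_nonneg_nonneg sum_nonneg)
  then show ?thesis
    by (simp add: sum_divide_distrib)
qed

section \<open>Spins that are constant on open clusters\<close>

definition compatible_spins :: "'a set \<Rightarrow> 'a set set \<Rightarrow> ('a \<Rightarrow> real) set" where
  "compatible_spins V A = {\<sigma> \<in> spin_configs V. \<forall>e\<in>A. \<forall>i\<in>e. \<forall>j\<in>e. \<sigma> i = \<sigma> j}"

lemma compatible_spins_subset: "compatible_spins V A \<subseteq> spin_configs V"
  unfolding compatible_spins_def by blast

lemma compatible_spins_joined: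
  assumes \<sigma>: "\<sigma> \<in> compatible_spins V A" and "(u, v) \<in> joined V A"
  shows "\<sigma> u = \<sigma> v"
proof -
  have "(u, v) \<in> {(i, j). {i, j} \<in> A}\<^sup>*"
    using assms(2) by (simp add: joined_def)
  then show ?thesis
  proof induction
    case (step y z)
    then have "\<sigma> y = \<sigma> z"
      using \<sigma> by (auto simp: compatible_spins_def)
    with step.IH show ?case by simp
  qed simp
qed

lemma component_of_eq_iff:
  assumes "u \<in> V" "v \<in> V"
  shows "component_of V A u = component_of V A v \<longleftrightarrow> (u, v) \<in> joined V A"
  unfolding component_of_def using assms by (rule eq_equiv_class_iff[OF equiv_joined])

lemma component_of_in_components: "u \<in> V \<Longrightarrow> component_of V A u \<in> components V A"
  using component_of_unique[THEN iffD2, OF _ refl] by (rule conjunct1)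

lemma component_fibre:
  assumes "K \<in> components V A"
  shows "{i \<in> V. component_of V A i = K} = K"
proof -
  have "K \<subseteq> V"
    using assms in_quotient_imp_subset[OF equiv_joined] by (auto simp: components_def)
  then show ?thesis
    using assms component_of_unique[of _ V K A] by auto
qed

lemma componentsE:
  assumes "K \<in> components V A"
  obtains u where "u \<in> V" "K = component_of V A u"
  using assms unfolding components_def component_of_def by (auto elim: quotientE)

lemma finite_components: "finite V \<Longrightarrow> finite (components V A)"
  unfolding components_def joined_def by (rule finite_quotient) auto

context finite_simple_graph
begin

text \<open>Spins that agree along each open edge agree along open paths, so they amount to one sign per
  cluster. With \<open>A \<subseteq> E\<close> all edges have both ends in \<open>V\<close>; an edge leaving \<open>V\<close> would compare a
  cluster sign with \<open>undefined\<close>.\<close>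

lemma bij_betw_cluster_spins:
  assumes "A \<subseteq> E"
  shows "bij_betw (\<lambda>\<tau>. \<lambda>i\<in>V. \<tau> (component_of V A i))
           (components V A \<rightarrow>\<^sub>E {-1, 1 :: real}) (compatible_spins V A)"
proof -
  have A: "e \<subseteq> V" and card: "card e = 2" if "e \<in> A" for e
    using that assms edge_subset edge_card by auto
  show ?thesis
  proof (rule bij_betwI')
    fix \<tau> \<tau>' :: "'a set \<Rightarrow> real"
    assume \<tau>: "\<tau> \<in> components V A \<rightarrow>\<^sub>E {-1, 1}" and \<tau>': "\<tau>' \<in> components V A \<rightarrow>\<^sub>E {-1, 1}"
    show "(\<lambda>i\<in>V. \<tau> (component_of V A i)) = (\<lambda>i\<in>V. \<tau>' (component_of V A i)) \<longleftrightarrow> \<tau> = \<tau>'"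
    proof
      assume eq: "(\<lambda>i\<in>V. \<tau> (component_of V A i)) = (\<lambda>i\<in>V. \<tau>' (component_of V A i))"
      show "\<tau> = \<tau>'"
      proof (rule PiE_ext[OF \<tau> \<tau>'])
        fix K assume "K \<in> components V A"
        then obtain u where "u \<in> V" "K = component_of V A u" by (rule componentsE)
        then show "\<tau> K = \<tau>' K"
          using fun_cong[OF eq, of u] by simp
      qed
    qed simp
  next
    fix \<tau> :: "'a set \<Rightarrow> real"
    assume \<tau>: "\<tau> \<in> components V A \<rightarrow>\<^sub>E {-1, 1}"
    have "component_of V A i = component_of V A j" if "e \<in> A" "i \<in> e" "j \<in> e" for e i j
    proof (cases "i = j")
      case False
      have "finite e" "card {i, j} = card e"
        using card[OF \<open>e \<in> A\<close>] False by (auto intro: card_ge_0_finite)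
      with that have "{i, j} = e"
        by (intro card_subset_eq) auto
      with that have "(i, j) \<in> joined V A"
        using A[OF \<open>e \<in> A\<close>] by (auto simp: joined_def)
      then show ?thesis
        using that A[OF \<open>e \<in> A\<close>] by (subst component_of_eq_iff) auto
    qed simp
    moreover have "i \<in> V" if "e \<in> A" "i \<in> e" for e i
      using that A by blast
    moreover have "\<tau> (component_of V A i) \<in> {-1, 1}" if "i \<in> V" for i
      using PiE_mem[OF \<tau> component_of_in_components[OF that]] .
    ultimately show "(\<lambda>i\<in>V. \<tau> (component_of V A i)) \<in> compatible_spins V A"
      unfolding compatible_spins_def spin_configs_def
      by (intro CollectI conjI ballI restrict_PiE_iff[THEN iffD2]) (blast, metis restrict_apply')
  next
    fix \<sigma> assume \<sigma>: "\<sigma> \<in> compatible_spins V A"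
    \<comment> \<open>The sign of a cluster is read off at any of its vertices.\<close>
    define \<tau> where "\<tau> = (\<lambda>K\<in>components V A. \<sigma> (SOME u. u \<in> K))"
    have \<tau>: "\<tau> (component_of V A u) = \<sigma> u" if "u \<in> V" for u
    proof -
      have "u \<in> component_of V A u"
        using component_of_unique[THEN iffD2, OF that refl] by (rule conjunct2)
      then have "(SOME v. v \<in> component_of V A u) \<in> component_of V A u"
        by (rule someI)
      then have "(u, SOME v. v \<in> component_of V A u) \<in> joined V A"
        by (simp add: component_of_def)
      from compatible_spins_joined[OF \<sigma> this] show ?thesis
        by (simp add: \<tau>_def component_of_in_components[OF that])
    qed
    have \<sigma>PiE: "\<sigma> \<in> V \<rightarrow>\<^sub>E {-1, 1}"
      using \<sigma> by (simp add: compatible_spins_def spin_configs_def)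
    have "\<tau> K \<in> {-1, 1}" if "K \<in> components V A" for K
      using that \<tau> PiE_mem[OF \<sigma>PiE] by (metis componentsE)
    then have "\<tau> \<in> components V A \<rightarrow>\<^sub>E {-1, 1}"
      unfolding \<tau>_def by (intro PiE_I) auto
    moreover have "\<sigma> = (\<lambda>i\<in>V. \<tau> (component_of V A i))"
      by (rule PiE_ext[OF \<sigma>PiE]) (use \<tau> PiE_mem[OF \<sigma>PiE] in auto)
    ultimately show "\<exists>\<tau>\<in>components V A \<rightarrow>\<^sub>E {-1, 1}. \<sigma> = (\<lambda>i\<in>V. \<tau> (component_of V A i))"
      by blast
  qed
qed

lemma sum_field_by_components:
  "\<beta> * (\<Sum>i\<in>V. h i * \<tau> (component_of V A i)) =
    (\<Sum>K\<in>components V A. \<tau> K * cluster_field \<beta> h K)"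
proof -
  have "(\<Sum>i\<in>V. h i * \<tau> (component_of V A i)) =
      (\<Sum>K\<in>components V A. \<Sum>i\<in>{i\<in>V. component_of V A i = K}. h i * \<tau> (component_of V A i))"
    using finite_V by (intro sum.group[symmetric] finite_components)
      (auto intro: component_of_in_components)
  also have "\<dots> = (\<Sum>K\<in>components V A. \<Sum>i\<in>K. h i * \<tau> K)"
  proof (rule sum.cong[OF refl])
    fix K assume "K \<in> components V A"
    have "(\<Sum>i\<in>{i\<in>V. component_of V A i = K}. h i * \<tau> (component_of V A i)) =
        (\<Sum>i\<in>{i\<in>V. component_of V A i = K}. h i * \<tau> K)"
      by (rule sum.cong) auto
    then show "(\<Sum>i\<in>{i\<in>V. component_of V A i = K}. h i * \<tau> (component_of V A i)) = (\<Sum>i\<in>K. h i * \<tau> K)"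
      by (simp only: component_fibre[OF \<open>K \<in> components V A\<close>])
  qed
  finally show ?thesis
    by (simp add: cluster_field_def sum_distrib_left mult_ac)
qed

text \<open>The factor \<open>g K s\<close> is the observable seen by cluster \<open>K\<close> when its sign is \<open>s\<close>. Allowing
  an arbitrary product observable covers the partition function and the numerator
  of the mean spin at once.\<close>

lemma sum_compatible_eq_prod_components:
  fixes g :: "'a set \<Rightarrow> real \<Rightarrow> real"
  assumes "A \<subseteq> E"
    and f: "\<And>\<tau>. f (\<lambda>i\<in>V. \<tau> (component_of V A i)) = (\<Prod>K\<in>components V A. g K (\<tau> K))"
  shows "(\<Sum>\<sigma>\<in>compatible_spins V A. f \<sigma> * exp (\<beta> * (\<Sum>i\<in>V. h i * \<sigma> i))) =
    (\<Prod>K\<in>components V A.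
       g K 1 * exp (cluster_field \<beta> h K) + g K (-1) * exp (- cluster_field \<beta> h K))"
proof -
  let ?F = "\<lambda>\<sigma>. f \<sigma> * exp (\<beta> * (\<Sum>i\<in>V. h i * \<sigma> i))"
  let ?w = "\<lambda>K s. g K s * exp (s * cluster_field \<beta> h K)"
  have "?F (\<lambda>i\<in>V. \<tau> (component_of V A i)) = (\<Prod>K\<in>components V A. ?w K (\<tau> K))" for \<tau>
    using sum_field_by_components[of \<beta> h \<tau> A]
    by (simp add: f exp_sum finite_components finite_V prod.distrib)
  then have "(\<Sum>\<sigma>\<in>compatible_spins V A. ?F \<sigma>) =
      (\<Sum>\<tau>\<in>components V A \<rightarrow>\<^sub>E {-1, 1}. \<Prod>K\<in>components V A. ?w K (\<tau> K))"
    using sum.reindex_bij_betw[OF bij_betw_cluster_spins[OF \<open>A \<subseteq> E\<close>], where g = ?F] by simp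
  also have "\<dots> = (\<Prod>K\<in>components V A. \<Sum>s\<in>{-1, 1}. ?w K s)"
    using finite_V by (subst prod_sum_PiE) (auto intro: finite_components)
  finally show ?thesis
    by (simp add: add.commute)
qed

end

section \<open>The coupling of spins and edges\<close>

lemma bernoulli_weight_eq_prod:
  assumes "finite E" and "\<omega> \<in> edge_configs E"
  shows "bernoulli_weight E p \<omega> = (\<Prod>e\<in>E. if \<omega> e = 1 then p e else 1 - p e)"
proof -
  have "{e \<in> E. \<omega> e = 0} = E \<inter> - {e. \<omega> e = 1}"
    using assms(2) by (auto simp: edge_configs_def dest: PiE_mem)
  then show ?thesis
    unfolding bernoulli_weight_def using assms(1)
    by (simp add: prod.If_cases Collect_conj_eq)
qed

lemma rc_weight_nonneg:
  assumes "\<And>e. e \<in> E \<Longrightarrow> 0 \<le> p e \<and> p e \<le> 1"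
  shows "0 \<le> rc_weight V E \<beta> p h \<omega>"
  unfolding rc_weight_def bernoulli_weight_def using assms
  by (intro mult_nonneg_nonneg prod_nonneg) auto

context finite_simple_graph
begin

lemma finite_edge_configs: "finite (edge_configs E)"
  unfolding edge_configs_def using finite_E by (intro finite_PiE) auto

lemma finite_spin_configs: "finite (spin_configs V)"
  unfolding spin_configs_def using finite_V by (intro finite_PiE) auto

lemma exp_edge_split:
  assumes "e \<in> E" and \<sigma>: "\<sigma> \<in> spin_configs V" and p: "p e = 1 - exp (- 2 * \<beta> * J e)"
  shows "exp (\<beta> * (J e * (\<Prod>i\<in>e. \<sigma> i))) =
    exp (\<beta> * J e) * ((1 - p e) + p e * of_bool (\<forall>i\<in>e. \<forall>j\<in>e. \<sigma> i = \<sigma> j))"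
proof -
  obtain i j where e: "e = {i, j}" "i \<noteq> j"
    using edge_card[OF \<open>e \<in> E\<close>] by (auto simp: card_2_iff)
  have agree: "(\<forall>k\<in>e. \<forall>l\<in>e. \<sigma> k = \<sigma> l) \<longleftrightarrow> \<sigma> i = \<sigma> j"
    using e by auto
  have unequal: "exp (- (\<beta> * J e)) = exp (\<beta> * J e) * (1 - p e)"
    by (simp add: p flip: exp_add)
  have prod: "(\<Prod>k\<in>e. \<sigma> k) = \<sigma> i * \<sigma> j"
    using e by simp
  have "\<sigma> i \<in> {-1, 1}" "\<sigma> j \<in> {-1, 1}"
    using \<sigma> edge_subset[OF \<open>e \<in> E\<close>] e by (auto simp: spin_configs_def)
  then consider "\<sigma> i = \<sigma> j" "\<sigma> i * \<sigma> j = 1" | "\<sigma> i \<noteq> \<sigma> j" "\<sigma> i * \<sigma> j = -1"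
    by auto
  then show ?thesis
    by cases (simp_all add: agree prod unequal)
qed

lemma ising_weight_expand:
  assumes \<sigma>: "\<sigma> \<in> spin_configs V" and p: "\<And>e. e \<in> E \<Longrightarrow> p e = 1 - exp (- 2 * \<beta> * J e)"
  shows "ising_weight V E \<beta> J h \<sigma> = exp (\<beta> * sum J E) *
    (\<Sum>\<omega>\<in>edge_configs E. bernoulli_weight E p \<omega> *
       (of_bool (\<sigma> \<in> compatible_spins V (open_edges E \<omega>)) * exp (\<beta> * (\<Sum>i\<in>V. h i * \<sigma> i))))"
proof -
  define c where "c e \<longleftrightarrow> (\<forall>i\<in>e. \<forall>j\<in>e. \<sigma> i = \<sigma> j)" for e
  have compatible: "\<sigma> \<in> compatible_spins V A \<longleftrightarrow> (\<forall>e\<in>A. c e)" for A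
    using \<sigma> unfolding compatible_spins_def c_def by blast
  let ?t = "\<lambda>e (n::nat). if n = 1 then p e * of_bool (c e) else 1 - p e"
  have edges: "(\<Prod>e\<in>E. ?t e (\<omega> e)) =
      bernoulli_weight E p \<omega> * of_bool (\<sigma> \<in> compatible_spins V (open_edges E \<omega>))"
    if "\<omega> \<in> edge_configs E" for \<omega>
  proof (cases "\<forall>e\<in>open_edges E \<omega>. c e")
    case True
    then have "(\<Prod>e\<in>E. ?t e (\<omega> e)) = (\<Prod>e\<in>E. if \<omega> e = 1 then p e else 1 - p e)"
      by (intro prod.cong) (auto simp: open_edges_def)
    with True show ?thesis
      by (simp add: bernoulli_weight_eq_prod[OF finite_E that] compatible)
  next
    case False
    then obtain e where e: "e \<in> E" "\<omega> e = 1" "\<not> c e"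
      by (auto simp: open_edges_def)
    then have "?t e (\<omega> e) = 0" by auto
    with e have "(\<Prod>e\<in>E. ?t e (\<omega> e)) = 0"
      by (intro prod_zero finite_E) blast
    moreover have "\<sigma> \<notin> compatible_spins V (open_edges E \<omega>)"
      using False by (simp add: compatible)
    ultimately show ?thesis by simp
  qed
  have "ising_weight V E \<beta> J h \<sigma> =
      (\<Prod>e\<in>E. exp (\<beta> * (J e * (\<Prod>i\<in>e. \<sigma> i)))) * exp (\<beta> * (\<Sum>i\<in>V. h i * \<sigma> i))"
    by (simp add: ising_weight_def exp_add sum_distrib_left exp_sum finite_E)
  also have "(\<Prod>e\<in>E. exp (\<beta> * (J e * (\<Prod>i\<in>e. \<sigma> i)))) =
      (\<Prod>e\<in>E. exp (\<beta> * J e) * ((1 - p e) + p e * of_bool (c e)))"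
    unfolding c_def by (intro prod.cong refl exp_edge_split \<sigma> p)
  also have "\<dots> = exp (\<beta> * sum J E) * (\<Prod>e\<in>E. \<Sum>n\<in>{0, 1}. ?t e n)"
    by (simp only: prod.distrib) (simp add: sum_distrib_left exp_sum finite_E)
  \<comment> \<open>Multiplying out chooses a summand for each edge, that is, an edge configuration.\<close>
  also have "(\<Prod>e\<in>E. \<Sum>n\<in>{0, 1}. ?t e n) = (\<Sum>\<omega>\<in>edge_configs E. \<Prod>e\<in>E. ?t e (\<omega> e))"
    unfolding edge_configs_def using finite_E by (subst prod_sum_PiE) auto
  also have "\<dots> = (\<Sum>\<omega>\<in>edge_configs E.
      bernoulli_weight E p \<omega> * of_bool (\<sigma> \<in> compatible_spins V (open_edges E \<omega>)))"
    by (intro sum.cong refl edges)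
  finally show ?thesis
    by (simp add: sum_distrib_right mult.assoc)
qed

lemma sum_ising_weight_eq_sum_clusters:
  assumes p: "\<And>e. e \<in> E \<Longrightarrow> p e = 1 - exp (- 2 * \<beta> * J e)"
  shows "(\<Sum>\<sigma>\<in>spin_configs V. ising_weight V E \<beta> J h \<sigma> * f \<sigma>) = exp (\<beta> * sum J E) *
    (\<Sum>\<omega>\<in>edge_configs E. bernoulli_weight E p \<omega> *
       (\<Sum>\<sigma>\<in>compatible_spins V (open_edges E \<omega>). f \<sigma> * exp (\<beta> * (\<Sum>i\<in>V. h i * \<sigma> i))))"
proof -
  let ?C = "\<lambda>\<omega>. compatible_spins V (open_edges E \<omega>)"
  let ?G = "\<lambda>\<sigma>. exp (\<beta> * (\<Sum>i\<in>V. h i * \<sigma> i))"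
  have inner: "(\<Sum>\<sigma>\<in>spin_configs V. of_bool (\<sigma> \<in> ?C \<omega>) * (f \<sigma> * ?G \<sigma>)) = (\<Sum>\<sigma>\<in>?C \<omega>. f \<sigma> * ?G \<sigma>)" for \<omega>
    using finite_spin_configs compatible_spins_subset
    by (intro sum.mono_neutral_cong_right) auto
  have "(\<Sum>\<sigma>\<in>spin_configs V. ising_weight V E \<beta> J h \<sigma> * f \<sigma>) =
      (\<Sum>\<sigma>\<in>spin_configs V. exp (\<beta> * sum J E) *
        (\<Sum>\<omega>\<in>edge_configs E. bernoulli_weight E p \<omega> * (of_bool (\<sigma> \<in> ?C \<omega>) * (f \<sigma> * ?G \<sigma>))))"
  proof (rule sum.cong[OF refl])
    fix \<sigma> assume "\<sigma> \<in> spin_configs V"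
    show "ising_weight V E \<beta> J h \<sigma> * f \<sigma> = exp (\<beta> * sum J E) *
        (\<Sum>\<omega>\<in>edge_configs E. bernoulli_weight E p \<omega> * (of_bool (\<sigma> \<in> ?C \<omega>) * (f \<sigma> * ?G \<sigma>)))"
      by (subst ising_weight_expand[OF \<open>\<sigma> \<in> spin_configs V\<close> p])
        (simp_all add: sum_distrib_left mult_ac)
  qed
  also have "\<dots> = exp (\<beta> * sum J E) * (\<Sum>\<omega>\<in>edge_configs E. bernoulli_weight E p \<omega> *
      (\<Sum>\<sigma>\<in>spin_configs V. of_bool (\<sigma> \<in> ?C \<omega>) * (f \<sigma> * ?G \<sigma>)))"
    by (simp only: sum_distrib_left[symmetric] sum.swap[of _ "edge_configs E"])
  finally show ?thesis
    by (simp only: inner)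
qed

lemma open_edges_subset: "open_edges E \<omega> \<subseteq> E"
  by (auto simp: open_edges_def)

lemma partition_function_ising_eq_rc:
  assumes p: "\<And>e. e \<in> E \<Longrightarrow> p e = 1 - exp (- 2 * \<beta> * J e)"
  shows "(\<Sum>\<sigma>\<in>spin_configs V. ising_weight V E \<beta> J h \<sigma>) =
    exp (\<beta> * sum J E) * (\<Sum>\<omega>\<in>edge_configs E. rc_weight V E \<beta> p h \<omega>)"
proof -
  have "(\<Sum>\<sigma>\<in>compatible_spins V (open_edges E \<omega>). 1 * exp (\<beta> * (\<Sum>i\<in>V. h i * \<sigma> i))) =
      (\<Prod>K\<in>components V (open_edges E \<omega>). 2 * cosh (cluster_field \<beta> h K))" for \<omega>
    by (subst sum_compatible_eq_prod_components[OF open_edges_subset,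
          where g = "\<lambda>_ _. 1"]) (simp_all add: cosh_def add_divide_distrib)
  then show ?thesis
    using sum_ising_weight_eq_sum_clusters[OF p, where f = "\<lambda>_. 1" and h = h]
    by (simp add: rc_weight_def)
qed

text \<open>Inserting the spin at \<open>x\<close> changes only the factor of the cluster of \<open>x\<close>, from \<open>2 * cosh\<close>
  to \<open>2 * sinh\<close>, which is the same as multiplying the whole product by \<open>tanh\<close>.\<close>

lemma spin_numerator_ising_eq_rc:
  assumes p: "\<And>e. e \<in> E \<Longrightarrow> p e = 1 - exp (- 2 * \<beta> * J e)" and "x \<in> V"
  shows "(\<Sum>\<sigma>\<in>spin_configs V. ising_weight V E \<beta> J h \<sigma> * \<sigma> x) =
    exp (\<beta> * sum J E) * (\<Sum>\<omega>\<in>edge_configs E. rc_weight V E \<beta> p h \<omega> *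
      tanh (cluster_field \<beta> h (component_of V (open_edges E \<omega>) x)))"
proof -
  have "(\<Sum>\<sigma>\<in>compatible_spins V (open_edges E \<omega>). \<sigma> x * exp (\<beta> * (\<Sum>i\<in>V. h i * \<sigma> i))) =
      (\<Prod>K\<in>components V (open_edges E \<omega>). 2 * cosh (cluster_field \<beta> h K)) *
        tanh (cluster_field \<beta> h (component_of V (open_edges E \<omega>) x))" for \<omega>
  proof -
    let ?A = "open_edges E \<omega>"
    let ?Kx = "component_of V ?A x"
    let ?H = "cluster_field \<beta> h"
    have fin: "finite (components V ?A)"
      by (rule finite_components[OF finite_V])
    have Kx: "?Kx \<in> components V ?A"
      by (rule component_of_in_components[OF \<open>x \<in> V\<close>])
    have "(\<Sum>\<sigma>\<in>compatible_spins V ?A. \<sigma> x * exp (\<beta> * (\<Sum>i\<in>V. h i * \<sigma> i))) =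
        (\<Prod>K\<in>components V ?A. (if K = ?Kx then 1 else 1) * exp (?H K) +
          (if K = ?Kx then - 1 else 1) * exp (- ?H K))"
      by (rule sum_compatible_eq_prod_components[OF open_edges_subset,
            where g = "\<lambda>K s. if K = ?Kx then s else 1"])
        (use \<open>x \<in> V\<close> fin Kx in auto)
    also have "\<dots> = (\<Prod>K\<in>components V ?A.
        (2 * cosh (?H K)) * (if K = ?Kx then tanh (?H K) else 1))"
    proof (rule prod.cong[OF refl])
      fix K
      have "exp (?H K) + exp (- ?H K) = 2 * cosh (?H K)"
        by (simp add: cosh_def)
      moreover have "exp (?H K) - exp (- ?H K) = 2 * cosh (?H K) * tanh (?H K)"
        by (simp add: tanh_def) (simp add: sinh_def)
      ultimately show "(if K = ?Kx then 1 else 1) * exp (?H K) +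
            (if K = ?Kx then - 1 else 1) * exp (- ?H K) =
          (2 * cosh (?H K)) * (if K = ?Kx then tanh (?H K) else 1)"
        by (cases "K = ?Kx") simp_all
    qed
    also have "\<dots> = (\<Prod>K\<in>components V ?A. 2 * cosh (?H K)) * tanh (?H ?Kx)"
      using fin Kx by (simp only: prod.distrib) simp
    finally show ?thesis .
  qed
  then show ?thesis
    using sum_ising_weight_eq_sum_clusters[OF p, where f = "\<lambda>\<sigma>. \<sigma> x" and h = h]
    by (simp add: rc_weight_def mult.assoc)
qed

end

section \<open>The mean spin\<close>

theorem corollary3:
  fixes V :: "'a set" and E :: "'a set set"
    and \<beta> :: real and J p :: "'a set \<Rightarrow> real" and h :: "'a \<Rightarrow> real" and x :: 'a
  assumes "finite_simple_graph V E"
    and "\<beta> > 0"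
    and "\<And>e. e \<in> E \<Longrightarrow> J e \<ge> 0"
    and "\<And>e. e \<in> E \<Longrightarrow> p e = 1 - exp (- 2 * \<beta> * J e)"
    and "x \<in> V"
  shows "(\<integral>\<sigma>. \<sigma> x \<partial>ising_measure V E \<beta> J h) =
    (\<integral>\<omega>. tanh (cluster_field \<beta> h (component_of V (open_edges E \<omega>) x)) \<partial>rc_measure V E \<beta> p h)"
proof -
  interpret finite_simple_graph V E by fact
  have "0 \<le> p e \<and> p e \<le> 1" if "e \<in> E" for e
    using assms(2-4) that by simp
  then have "0 \<le> rc_weight V E \<beta> p h \<omega>" for \<omega>
    by (rule rc_weight_nonneg)
  moreover have "0 \<le> ising_weight V E \<beta> J h \<sigma>" for \<sigma>
    by (simp add: ising_weight_def)
  ultimately show ?thesis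
    unfolding ising_measure_def rc_measure_def
    by (simp add: integral_normalized_measure finite_spin_configs finite_edge_configs
        partition_function_ising_eq_rc[OF assms(4)] spin_numerator_ising_eq_rc[OF assms(4,5)])
qed

end
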